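(* Let $H=\{123,124,345,156\}$, a $3$-graph on the vertex set $\{1,\dots,6\}$. Then $\pi(H)=2/9$.
   Context: A $3$-graph is a pair $(V,E)$ where $V$ is a finite vertex set and $E$ is a set of $3$-element subsets of $V$ (edges); it is identified with its edge set, and $abc$ denotes the edge $\{a,b,c\}$. $e(G)$ is the number of edges of $G$. For a family $\mathcal{F}$ of $3$-graphs, a $3$-graph is $\mathcal{F}$-free if it contains no (not necessarily induced) subgraph isomorphic to a member of $\mathcal{F}$. Define $\mathrm{ex}(n,\mathcal{F})=\max\{e(G): G \text{ is } \mathcal{F}\text{-free}, |V(G)|=n\}$ and the Turán density $\pi(\mathcal{F})=\lim_{n\to\infty}\mathrm{ex}(n,\mathcal{F})/\binom{n}{3}$ (the limit always exists). For a single $3$-graph $F$, $\pi(F)=\pi(\{F\})$. *)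

theory Defs
  imports Complex_Main
begin

type_synonym 'a hgraph = "'a set \<times> 'a set set"

abbreviation hverts :: "'a hgraph \<Rightarrow> 'a set" where "hverts G \<equiv> fst G"

abbreviation hedges :: "'a hgraph \<Rightarrow> 'a set set" where "hedges G \<equiv> snd G"

definition three_graph :: "'a hgraph \<Rightarrow> bool" where
  "three_graph G \<longleftrightarrow> finite (hverts G) \<and> (\<forall>e\<in>hedges G. e \<subseteq> hverts G \<and> card e = 3)"

definition hsubgraph :: "'a hgraph \<Rightarrow> 'a hgraph \<Rightarrow> bool" where
  "hsubgraph G' G \<longleftrightarrow> three_graph G' \<and> hverts G' \<subseteq> hverts G \<and> hedges G' \<subseteq> hedges G"

definition hisomorphic :: "'a hgraph \<Rightarrow> 'b hgraph \<Rightarrow> bool" where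
  "hisomorphic F G \<longleftrightarrow>
     (\<exists>f. bij_betw f (hverts F) (hverts G) \<and> hedges G = (\<lambda>e. f ` e) ` hedges F)"

definition family_free :: "'b hgraph set \<Rightarrow> 'a hgraph \<Rightarrow> bool" where
  "family_free \<F> G \<longleftrightarrow> \<not> (\<exists>F\<in>\<F>. \<exists>G'. hsubgraph G' G \<and> hisomorphic F G')"

text \<open>
  Host graphs have vertices of type \<^typ>\<open>nat\<close>, which loses nothing, since every finite graph is
  isomorphic to such a graph. The maximum is over a nonempty finite set whenever all
  members of the family have an edge, see \<open>ex_candidates_finite\<close> and
  \<open>ex_candidates_nonempty\<close> below; if it is over the empty set, the value is unspecified.
\<close>

definition ex_candidates :: "nat \<Rightarrow> 'b hgraph set \<Rightarrow> nat set" where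
  "ex_candidates n \<F> =
     {card (hedges G) | G :: nat hgraph.
        three_graph G \<and> card (hverts G) = n \<and> family_free \<F> G}"

definition ex_number :: "nat \<Rightarrow> 'b hgraph set \<Rightarrow> nat" where
  "ex_number n \<F> = Max (ex_candidates n \<F>)"

text \<open>
  The limit exists as soon as all members of the family have an edge, see
  \<open>turan_density_LIMSEQ\<close> below, so \<^const>\<open>lim\<close> has its intended value.
\<close>

definition turan_density :: "'b hgraph set \<Rightarrow> real" where
  "turan_density \<F> = lim (\<lambda>n. real (ex_number n \<F>) / real (n choose 3))"

definition H_graph :: "nat hgraph" where
  "H_graph = ({1..6}, {{1,2,3}, {1,2,4}, {3,4,5}, {1,5,6}})"

lemma three_graph_H_graph: "three_graph H_graph"
  by (auto simp: three_graph_def H_graph_def)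

lemma finite_hedges: "three_graph G \<Longrightarrow> finite (hedges G)"
  unfolding three_graph_def by (meson Pow_iff finite_Pow_iff finite_subset subsetI)

lemma ex_candidates_finite: "finite (ex_candidates n \<F>)"
proof -
  have "ex_candidates n \<F> \<subseteq> {..2 ^ n}"
  proof (clarsimp simp: ex_candidates_def)
    fix V :: "nat set" and E
    assume G: "three_graph (V, E)"
    then have "E \<subseteq> Pow V" "finite V" by (auto simp: three_graph_def)
    then show "card E \<le> 2 ^ card V"
      by (metis card_Pow card_mono finite_Pow_iff)
  qed
  then show ?thesis by (rule finite_subset) simp
qed

lemma ex_candidates_nonempty:
  assumes "\<forall>F\<in>\<F>. hedges F \<noteq> {}"
  shows "ex_candidates n \<F> \<noteq> {}"
proof -
  have "three_graph ({..<n}, {})" by (simp add: three_graph_def)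
  moreover have "family_free \<F> ({..<n}, {})"
    using assms by (auto simp: family_free_def hsubgraph_def hisomorphic_def)
  ultimately have "card (hedges ({..<n}, {} :: nat set set)) \<in> ex_candidates n \<F>"
    unfolding ex_candidates_def by fastforce
  then show ?thesis by blast
qed

lemma family_free_mono:
  "family_free \<F> G \<Longrightarrow> hverts G' \<subseteq> hverts G \<Longrightarrow> hedges G' \<subseteq> hedges G \<Longrightarrow> family_free \<F> G'"
  unfolding family_free_def hsubgraph_def by (meson subset_trans)

lemma ex_number_averaging:
  assumes "\<forall>F\<in>\<F>. hedges F \<noteq> {}" "n \<ge> 2"
  shows "(n - 2) * ex_number (Suc n) \<F> \<le> Suc n * ex_number n \<F>"
proof -
  have "ex_number (Suc n) \<F> \<in> ex_candidates (Suc n) \<F>"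
    unfolding ex_number_def
    by (rule Max_in[OF ex_candidates_finite ex_candidates_nonempty[OF assms(1)]])
  then obtain V E where G: "three_graph (V, E)" "card V = Suc n" "family_free \<F> (V, E)"
    and ex: "ex_number (Suc n) \<F> = card (E :: nat set set)"
    by (auto simp: ex_candidates_def)
  have fin: "finite V" "finite E"
    using G(1) finite_hedges[OF G(1)] by (auto simp: three_graph_def)
  have E: "e \<subseteq> V \<and> card e = 3" if "e \<in> E" for e
    using G(1) that by (auto simp: three_graph_def)
  have del: "card {e\<in>E. v \<notin> e} \<le> ex_number n \<F>" if "v \<in> V" for v
  proof -
    have "three_graph (V - {v}, {e\<in>E. v \<notin> e})"
      using G(1) by (auto simp: three_graph_def)
    moreover have "card (V - {v}) = n" using that G(2) by simp
    moreover have "family_free \<F> (V - {v}, {e\<in>E. v \<notin> e})"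
      by (rule family_free_mono[OF G(3)]) auto
    ultimately have "card {e\<in>E. v \<notin> e} \<in> ex_candidates n \<F>"
      unfolding ex_candidates_def by fastforce
    then show ?thesis
      unfolding ex_number_def by (rule Max_ge[OF ex_candidates_finite])
  qed
  have "card {v\<in>V. v \<notin> e} = n - 2" if "e \<in> E" for e
  proof -
    have "{v\<in>V. v \<notin> e} = V - e" by auto
    moreover have "finite e" using E[OF that] fin finite_subset by blast
    ultimately show ?thesis using E[OF that] G(2) by (simp add: card_Diff_subset)
  qed
  then have "(\<Sum>v\<in>V. card {e\<in>E. v \<notin> e}) = (n - 2) * card E"
    using sum_multicount_gen[OF fin(1) fin(2), of "\<lambda>v e. v \<notin> e" "\<lambda>_. n - 2"]
    by (simp add: mult.commute)
  moreover have "(\<Sum>v\<in>V. card {e\<in>E. v \<notin> e}) \<le> Suc n * ex_number n \<F>"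
    using sum_bounded_above[of V "\<lambda>v. card {e\<in>E. v \<notin> e}" "ex_number n \<F>"] del G(2)
    by simp
  ultimately show ?thesis by (simp add: ex)
qed

lemma turan_density_LIMSEQ:
  assumes "\<forall>F\<in>\<F>. hedges F \<noteq> {}"
  shows "(\<lambda>n. real (ex_number n \<F>) / real (n choose 3)) \<longlonglongrightarrow> turan_density \<F>"
proof -
  define x where "x n = real (ex_number n \<F>) / real (n choose 3)" for n
  have "x (Suc n) \<le> x n" if n: "n \<ge> 3" for n
  proof -
    have pos: "real (n choose 3) > 0" "real (Suc n choose 3) > 0" using n by auto
    have "(n - 2) * (Suc n choose 3) = Suc n * (n choose 3)"
      using binomial_absorb_comp[of "Suc n" 3] n by (simp del: binomial_Suc_Suc)
    then have c: "real (n - 2) * real (Suc n choose 3) = real (Suc n) * real (n choose 3)"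
      by (metis of_nat_mult)
    have a: "real (n - 2) * real (ex_number (Suc n) \<F>) \<le> real (Suc n) * real (ex_number n \<F>)"
      using ex_number_averaging[OF assms, of n] n by (metis of_nat_le_iff of_nat_mult
        numeral_le_iff order_trans semiring_norm(69) semiring_norm(71) Suc_leD eval_nat_numeral(3))
    have "real (n - 2) * real (ex_number (Suc n) \<F>) * real (n choose 3)
        \<le> real (Suc n) * real (ex_number n \<F>) * real (n choose 3)"
      by (rule mult_right_mono[OF a]) simp
    also have "\<dots> = real (n - 2) * (real (ex_number n \<F>) * real (Suc n choose 3))"
      using c by (simp add: mult_ac)
    finally have "real (ex_number (Suc n) \<F>) * real (n choose 3)
        \<le> real (ex_number n \<F>) * real (Suc n choose 3)"
      using n by (simp add: mult.assoc del: binomial_Suc_Suc)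
    then show ?thesis using pos
      by (simp add: x_def frac_le_eq divide_le_eq le_divide_eq field_simps del: binomial_Suc_Suc)
  qed
  then have "decseq (\<lambda>n. x (n + 3))"
    unfolding decseq_Suc_iff add_Suc by (metis le_add2)
  moreover have "0 \<le> x (n + 3)" for n by (simp add: x_def)
  ultimately obtain L where "(\<lambda>n. x (n + 3)) \<longlonglongrightarrow> L" using decseq_convergent by blast
  then have "x \<longlonglongrightarrow> L" by (rule LIMSEQ_offset)
  then have "x \<longlonglongrightarrow> lim x" by (simp add: limI)
  then show ?thesis by (simp add: turan_density_def x_def[abs_def])
qed

end

theory Submission
  imports Defs "HOL-Analysis.Convex"
begin

text \<open>
  Lower bound: the balanced complete tripartite 3-graph has asymptotic density $2/9$. It contains
  no copy of $H$, since two edges $123$, $124$ put $3$ and $4$ into the same part, which no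
  edge $345$ allows.

  Upper bound: call a 3-graph hom-free if it admits no homomorphism from $H$, injective or not.
  The Lagrangian of a hom-free 3-graph is at most $1/27$ (\<open>H_hom_free_weight_le\<close>), so a hom-free
  3-graph on $k$ vertices has at most $k^3/27$ edges. To see this, put weights of total mass $1$
  on the vertices. The total weight of the edges is affine along any exchange of mass between two
  vertices that share no edge, so one of the two can be emptied without loss
  (\<open>weight_shift\<close>). This ends at a support in which every pair lies in an edge. A hom-free
  3-graph with this property is linear, that is, two edges share at most one vertex: if $uva$ and
  $uvb$ are edges, cover the pair $ab$ by an edge $abc$ and then the pair $uc$ (or $vc$, if
  $c = u$) to obtain an image of $H$ (\<open>covering_H_hom_free_linear\<close>). For linear 3-graphs
  the bound $1/27$ follows from a pointwise inequality (\<open>linear_weight_le\<close>).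

  It remains to pass from copies to homomorphic images. A 3-graph on $n$ vertices without a copy
  of $H$ has only $O(n^5)$ homomorphisms from $H$, because all of them identify two vertices. By
  Cauchy-Schwarz, a positive density of some proper image of $H$ would force a positive density of
  homomorphisms (\<open>card_duplicate\<close>). Hence a random $k$-subset of the vertices is hom-free with
  probability tending to $1$ as $n$ grows. Averaging the edge count over all
  $k$-subsets gives Turan density at most $(k^3/27) / {k \choose 3}$ (\<open>edge_density_le\<close>), and
  this tends to $6/27$ as $k$ grows.
\<close>

section \<open>Homomorphic images of H\<close>

text \<open>
  The six vertices need not be distinct: these are the homomorphisms from $H$. If all members of
  \<open>E\<close> have three elements, vertices in a common edge of $H$ have distinct images.
\<close>

definition H_hom :: "'a set set \<Rightarrow> 'a \<Rightarrow> 'a \<Rightarrow> 'a \<Rightarrow> 'a \<Rightarrow> 'a \<Rightarrow> 'a \<Rightarrow> bool" where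
  "H_hom E a b c d e f \<longleftrightarrow> {a,b,c} \<in> E \<and> {a,b,d} \<in> E \<and> {c,d,e} \<in> E \<and> {a,e,f} \<in> E"

definition H_hom_free_on :: "'a set set \<Rightarrow> 'a set \<Rightarrow> bool" where
  "H_hom_free_on E S \<longleftrightarrow> (\<forall>a\<in>S. \<forall>b\<in>S. \<forall>c\<in>S. \<forall>d\<in>S. \<forall>e\<in>S. \<forall>f\<in>S. \<not> H_hom E a b c d e f)"

lemma triple_distinct:
  assumes "card {a,b,c} = 3"
  shows "a \<noteq> b" "a \<noteq> c" "b \<noteq> c"
  using assms by (auto simp: card_insert_if split: if_splits)

lemma triple_third:
  assumes "card e = 3" "u \<in> e" "v \<in> e" "u \<noteq> v"
  obtains w where "e = {u,v,w}" "w \<noteq> u" "w \<noteq> v"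
proof -
  obtain a b c where "e = {a,b,c}" "a \<noteq> b" "a \<noteq> c" "b \<noteq> c"
    using assms(1) by (auto simp: card_3_iff)
  then show thesis using assms that by (metis empty_iff insertE insert_commute)
qed

section \<open>The Lagrangian of a linear 3-graph\<close>

definition off_diag :: "'a set \<Rightarrow> ('a \<times> 'a) set" where
  "off_diag A = A \<times> A - Id"

text \<open>
  In a linear family the sets of ordered pairs inside the members are pairwise disjoint.
\<close>

lemma sum_off_diag_linear:
  fixes g :: "'a \<Rightarrow> 'a \<Rightarrow> real"
  assumes "finite S" "F \<subseteq> Pow S"
    and lin: "\<And>e e' u v. e \<in> F \<Longrightarrow> e' \<in> F \<Longrightarrow> u \<in> e \<inter> e' \<Longrightarrow> v \<in> e \<inter> e' \<Longrightarrow> u \<noteq> v \<Longrightarrow> e = e'"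
    and nonneg: "\<And>u v. u \<in> S \<Longrightarrow> v \<in> S \<Longrightarrow> g u v \<ge> 0"
  shows "(\<Sum>e\<in>F. \<Sum>(u,v)\<in>off_diag e. g u v) \<le> (\<Sum>(u,v)\<in>off_diag S. g u v)"
proof -
  have "finite e" if "e \<in> F" for e
    using assms(1,2) that by (auto intro: finite_subset)
  then have fin: "finite F" "\<forall>e\<in>F. finite (off_diag e)" "finite (off_diag S)"
    using assms(1,2) by (auto simp: off_diag_def intro: finite_subset)
  have disj: "off_diag e \<inter> off_diag e' = {}" if "e \<in> F" "e' \<in> F" "e \<noteq> e'" for e e'
    using lin[OF that(1,2)] that(3) unfolding off_diag_def by blast
  have "(\<Sum>e\<in>F. \<Sum>(u,v)\<in>off_diag e. g u v) = (\<Sum>(u,v)\<in>(\<Union>e\<in>F. off_diag e). g u v)"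
    using fin disj by (intro sum.UNION_disjoint[symmetric]) auto
  also have "\<dots> \<le> (\<Sum>(u,v)\<in>off_diag S. g u v)"
    using assms(2) nonneg by (intro sum_mono2 fin) (auto simp: off_diag_def)
  finally show ?thesis .
qed

text \<open>
  Writing $a$, $b$, $c$ for the weights on an edge, AM-GM and $a + b + c \<le> 1$ give
  $36abc \<le> \sum x_u x_v (1 + 3x_v)$ over the ordered pairs $(u,v)$ in the edge. By linearity the
  sum over all edges is at most
  $\sum_{u \<noteq> v} x_u x_v (1 + 3x_v) = \sum_v x_v (1 + 3x_v)(1 - x_v)$, and
  $(1 + 3t)(1 - t) = 4/3 - 3(t - 1/3)^2$. The two summands $1$ and $3x_v$ are balanced so that all
  steps are tight for a single edge with weights $1/3$.
\<close>

lemma linear_weight_le: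
  fixes x :: "'a \<Rightarrow> real"
  assumes "finite S" "F \<subseteq> Pow S" "\<And>e. e \<in> F \<Longrightarrow> card e = 3"
    and lin: "\<And>e e' u v. e \<in> F \<Longrightarrow> e' \<in> F \<Longrightarrow> u \<in> e \<inter> e' \<Longrightarrow> v \<in> e \<inter> e' \<Longrightarrow> u \<noteq> v \<Longrightarrow> e = e'"
    and x: "\<And>v. v \<in> S \<Longrightarrow> x v \<ge> 0" "sum x S = 1"
  shows "(\<Sum>e\<in>F. prod x e) \<le> 1 / 27"
proof -
  define g where "g u v = x u * (x v * (1 + 3 * x v))" for u v
  have "36 * prod x e \<le> (\<Sum>(u,v)\<in>off_diag e. g u v)" if e: "e \<in> F" for e
  proof -
    obtain a b c where abc: "e = {a,b,c}" "a \<noteq> b" "a \<noteq> c" "b \<noteq> c"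
      using assms(3)[OF e] by (auto simp: card_3_iff)
    have S: "a \<in> S" "b \<in> S" "c \<in> S" "e \<subseteq> S" using assms(2) e abc by auto
    have "sum x e \<le> sum x S" using S assms(1) x(1) by (intro sum_mono2) auto
    then have le1: "x a + x b + x c \<le> 1" using abc x(2) by simp
    have nn: "x a \<ge> 0" "x b \<ge> 0" "x c \<ge> 0" using S x(1) by auto
    have off: "off_diag e = {(a,b),(b,a),(a,c),(c,a),(b,c),(c,b)}"
      using abc by (auto simp: off_diag_def)
    have "9 * (x a * x b * x c) \<le> (x a * x b + x b * x c + x a * x c) * (x a + x b + x c)"
      using mult_nonneg_nonneg[OF nn(1) zero_le_power2[of "x b - x c"]]
        mult_nonneg_nonneg[OF nn(2) zero_le_power2[of "x a - x c"]]
        mult_nonneg_nonneg[OF nn(3) zero_le_power2[of "x a - x b"]]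
      by (simp add: power2_eq_square algebra_simps)
    also have "\<dots> \<le> (x a * x b + x b * x c + x a * x c) * 1"
      using le1 nn by (intro mult_left_mono) auto
    finally have 1: "9 * (x a * x b * x c) \<le> x a * x b + x b * x c + x a * x c" by simp
    \<comment> \<open>The part of the sum carrying the factor \<open>3 * x v\<close>; together with the bound above it
      contributes $18 + 18 = 36$ times the weight of the edge.\<close>
    have 2: "6 * (x a * x b * x c) \<le> x a * (x b)\<^sup>2 + x a * (x c)\<^sup>2 + x b * (x a)\<^sup>2 + x b * (x c)\<^sup>2
        + x c * (x a)\<^sup>2 + x c * (x b)\<^sup>2"
      using mult_nonneg_nonneg[OF nn(1) zero_le_power2[of "x b - x c"]]
        mult_nonneg_nonneg[OF nn(2) zero_le_power2[of "x a - x c"]]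
        mult_nonneg_nonneg[OF nn(3) zero_le_power2[of "x a - x b"]]
      by (simp add: power2_eq_square algebra_simps)
    have "(\<Sum>(u,v)\<in>off_diag e. g u v) = 2 * (x a * x b + x b * x c + x a * x c)
        + 3 * (x a * (x b)\<^sup>2 + x a * (x c)\<^sup>2 + x b * (x a)\<^sup>2 + x b * (x c)\<^sup>2
        + x c * (x a)\<^sup>2 + x c * (x b)\<^sup>2)"
      using abc(2-4) abc(2-4)[symmetric] unfolding off
      by (simp add: g_def power2_eq_square algebra_simps)
    moreover have "prod x e = x a * x b * x c" using abc by simp
    moreover have "36 * p \<le> 2 * s + 3 * t" if "9 * p \<le> s" "6 * p \<le> t" for p s t :: real
      using that by linarith
    ultimately show ?thesis using 1 2 by metis
  qed
  then have "36 * (\<Sum>e\<in>F. prod x e) \<le> (\<Sum>e\<in>F. \<Sum>(u,v)\<in>off_diag e. g u v)"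
    unfolding sum_distrib_left by (rule sum_mono)
  also have "\<dots> \<le> (\<Sum>(u,v)\<in>off_diag S. g u v)"
    using assms(1,2) lin x(1) by (intro sum_off_diag_linear) (auto simp: g_def)
  also have "\<dots> = (\<Sum>(u,v)\<in>S \<times> S. g u v) - (\<Sum>v\<in>S. g v v)"
  proof -
    have "off_diag S = S \<times> S - (\<lambda>v. (v,v)) ` S" by (auto simp: off_diag_def)
    moreover have "(\<Sum>(u,v)\<in>(\<lambda>v. (v,v)) ` S. g u v) = (\<Sum>v\<in>S. g v v)"
      by (subst sum.reindex) (auto simp: inj_on_def)
    moreover have "(\<lambda>v. (v,v)) ` S \<subseteq> S \<times> S" by auto
    ultimately show ?thesis using assms(1) by (simp add: sum_diff)
  qed
  also have "(\<Sum>(u,v)\<in>S \<times> S. g u v) = (\<Sum>v\<in>S. x v * (1 + 3 * x v))"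
    unfolding g_def sum.cartesian_product[symmetric] sum_product[symmetric] x(2) by simp
  also have "\<dots> - (\<Sum>v\<in>S. g v v) = (\<Sum>v\<in>S. 4 / 3 * x v - 3 * (x v * (x v - 1 / 3)\<^sup>2))"
    unfolding sum_subtractf[symmetric]
    by (rule sum.cong) (auto simp: g_def power2_eq_square algebra_simps)
  also have "\<dots> = 4 / 3 - 3 * (\<Sum>v\<in>S. x v * (x v - 1 / 3)\<^sup>2)"
    unfolding sum_subtractf sum_distrib_left[symmetric] x(2) by simp
  also have "\<dots> \<le> 4 / 3"
    using x(1) by (simp add: sum_nonneg)
  finally show ?thesis by simp
qed

section \<open>The Lagrangian of a hom-free 3-graph\<close>

text \<open>
  Two edges $uva$ and $uvb$ with $a \<noteq> b$, an edge $abc$ and an edge $pcd$ with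
  $p \<in> \{u,v\} - \{c\}$ form an image of $H$ with $p$ in the role of $1$. The roles of
  $2$ and $5$ may fall on the same vertex, in which case the image is $K_4^-$.
\<close>

lemma covering_H_hom_free_linear:
  assumes unif: "\<And>e. e \<in> E \<Longrightarrow> card e = 3"
    and free: "H_hom_free_on E S"
    and cov: "\<And>u v. u \<in> S \<Longrightarrow> v \<in> S \<Longrightarrow> u \<noteq> v \<Longrightarrow> \<exists>e\<in>E. e \<subseteq> S \<and> u \<in> e \<and> v \<in> e"
    and e: "e \<in> E" "e \<subseteq> S" "e' \<in> E" "e' \<subseteq> S"
    and uv: "u \<in> e \<inter> e'" "v \<in> e \<inter> e'" "u \<noteq> v"
  shows "e = e'"
proof (rule ccontr)
  assume ne: "e \<noteq> e'"
  obtain a where a: "e = {u,v,a}" using triple_third[of e u v] unif e uv by auto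
  obtain b where b: "e' = {u,v,b}" using triple_third[of e' u v] unif e uv by auto
  have cov': "\<exists>w\<in>S. {p,q,w} \<in> E" if pq: "p \<in> S" "q \<in> S" "p \<noteq> q" for p q
  proof -
    obtain h where "h \<in> E" "h \<subseteq> S" "p \<in> h" "q \<in> h" using cov pq by blast
    moreover from this obtain w where "h = {p,q,w}" using triple_third[of h p q] unif pq by auto
    ultimately show ?thesis by auto
  qed
  have ab: "a \<noteq> b" "a \<in> S" "b \<in> S" "u \<in> S" "v \<in> S" using ne a b e by auto
  obtain c where c: "c \<in> S" "{a,b,c} \<in> E" using cov'[of a b] ab by auto
  \<comment> \<open>Stated symmetrically in \<open>u\<close> and \<open>v\<close>, as \<open>c\<close> can coincide with one of them but not
    with both.\<close>
  have False if pq: "p \<in> S" "q \<in> S" "p \<noteq> c" "{p,q,a} \<in> E" "{p,q,b} \<in> E" for p q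
  proof -
    obtain d where "d \<in> S" "{p,c,d} \<in> E" using cov'[of p c] pq c by auto
    then have "H_hom E p q a b c d" using pq c by (simp add: H_hom_def)
    then show False using free pq ab c \<open>d \<in> S\<close> unfolding H_hom_free_on_def by blast
  qed
  from this[of u v] this[of v u] show False
    using ab uv(3) a b e by (metis insert_commute)
qed

text \<open>
  Zykov symmetrization for weights. As no edge contains both \<open>u\<close> and \<open>v\<close>, the total weight
  is $A + x_u D_u + x_v D_v$ with $A$, $D_u$, $D_v$ independent of $x_u$ and $x_v$, so moving
  the mass of \<open>v\<close> to the vertex \<open>u\<close> with the larger coefficient costs nothing.
\<close>

lemma weight_shift:
  fixes x :: "'a \<Rightarrow> real"
  assumes "finite F" "\<And>e. e \<in> F \<Longrightarrow> finite e"
    and uncov: "\<And>e. e \<in> F \<Longrightarrow> \<not> (u \<in> e \<and> v \<in> e)" and "u \<noteq> v" and "x v \<ge> 0"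
    and le: "(\<Sum>e | e \<in> F \<and> v \<in> e. prod x (e - {v})) \<le> (\<Sum>e | e \<in> F \<and> u \<in> e. prod x (e - {u}))"
  shows "(\<Sum>e\<in>F. prod x e) \<le> (\<Sum>e | e \<in> F \<and> v \<notin> e. prod (x(u := x u + x v)) e)"
proof -
  let ?D = "\<lambda>w. \<Sum>e | e \<in> F \<and> w \<in> e. prod x (e - {w})"
  let ?y = "x(u := x u + x v)"
  let ?A = "\<Sum>e | e \<in> F \<and> u \<notin> e \<and> v \<notin> e. prod x e"
  have split: "(\<Sum>e | e \<in> F \<and> v \<notin> e. f e) = (\<Sum>e | e \<in> F \<and> u \<notin> e \<and> v \<notin> e. f e) + (\<Sum>e | e \<in> F \<and> u \<in> e. f e)"
    for f :: "'a set \<Rightarrow> real"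
    using assms(1) uncov by (subst sum.union_disjoint[symmetric]) (auto intro!: sum.cong)
  have D: "(\<Sum>e | e \<in> F \<and> w \<in> e. prod x e) = x w * ?D w" for w
    unfolding sum_distrib_left by (rule sum.cong) (auto simp: assms(2) prod.remove)
  have "(\<Sum>e\<in>F. prod x e) = (\<Sum>e | e \<in> F \<and> v \<notin> e. prod x e) + (\<Sum>e | e \<in> F \<and> v \<in> e. prod x e)"
    using assms(1) by (subst sum.union_disjoint[symmetric]) (auto intro!: sum.cong)
  also have "\<dots> = ?A + x u * ?D u + x v * ?D v"
    by (simp add: split D)
  also have "\<dots> \<le> ?A + (x u + x v) * ?D u"
    using mult_left_mono[OF le \<open>x v \<ge> 0\<close>] by (simp add: algebra_simps)
  also have "\<dots> = (\<Sum>e | e \<in> F \<and> v \<notin> e. prod ?y e)"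
  proof -
    have "(\<Sum>e | e \<in> F \<and> u \<in> e. prod ?y e) = (x u + x v) * ?D u"
      unfolding sum_distrib_left
    proof (rule sum.cong[OF refl])
      fix e assume "e \<in> {e. e \<in> F \<and> u \<in> e}"
      then have "prod ?y e = ?y u * prod ?y (e - {u})" using assms(2) by (intro prod.remove) auto
      also have "prod ?y (e - {u}) = prod x (e - {u})" by (rule prod.cong) auto
      finally show "prod ?y e = (x u + x v) * prod x (e - {u})" by simp
    qed
    moreover have "(\<Sum>e | e \<in> F \<and> u \<notin> e \<and> v \<notin> e. prod ?y e) = ?A"
      by (intro sum.cong prod.cong) auto
    ultimately show ?thesis by (simp add: split)
  qed
  finally show ?thesis .
qed

text \<open>
  Induction on the support: an uncovered pair allows it to shrink by a shift, and without such a
  pair the 3-graph is linear.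
\<close>

lemma H_hom_free_weight_le:
  fixes x :: "'a \<Rightarrow> real"
  assumes unif: "\<And>e. e \<in> E \<Longrightarrow> card e = 3"
    and "finite S" "H_hom_free_on E S" "\<And>v. v \<in> S \<Longrightarrow> x v \<ge> 0" "sum x S = 1"
  shows "(\<Sum>e | e \<in> E \<and> e \<subseteq> S. prod x e) \<le> 1 / 27"
  using assms(2-)
proof (induction S arbitrary: x rule: finite_psubset_induct)
  case (psubset S)
  define F where "F = {e. e \<in> E \<and> e \<subseteq> S}"
  have F: "finite F" "\<And>e. e \<in> F \<Longrightarrow> finite e"
    using psubset.hyps finite_subset[of F "Pow S"] by (auto simp: F_def intro: finite_subset)
  show ?case
  proof (cases "\<forall>u\<in>S. \<forall>v\<in>S. u \<noteq> v \<longrightarrow> (\<exists>e\<in>E. e \<subseteq> S \<and> u \<in> e \<and> v \<in> e)")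
    case True
    show ?thesis
    proof (rule linear_weight_le[OF psubset.hyps])
      show "e = e'" if "e \<in> {e. e \<in> E \<and> e \<subseteq> S}" "e' \<in> {e. e \<in> E \<and> e \<subseteq> S}"
        "u \<in> e \<inter> e'" "v \<in> e \<inter> e'" "u \<noteq> v" for e e' u v
        using covering_H_hom_free_linear[OF unif psubset.prems(1), of e e' u v] True that by blast
    qed (use unif psubset.prems in auto)
  next
    case False
    then obtain u v where uv: "u \<in> S" "v \<in> S" "u \<noteq> v"
      and unc: "\<And>e. e \<in> F \<Longrightarrow> \<not> (u \<in> e \<and> v \<in> e)"
      unfolding F_def by blast
    let ?D = "\<lambda>w. \<Sum>e | e \<in> F \<and> w \<in> e. prod x (e - {w})"
    have shift: "(\<Sum>e\<in>F. prod x e) \<le> 1 / 27"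
      if p: "p \<in> S" and q: "q \<in> S" and "p \<noteq> q"
        and pq: "\<And>e. e \<in> F \<Longrightarrow> \<not> (p \<in> e \<and> q \<in> e)" and le: "?D q \<le> ?D p" for p q
    proof -
      let ?y = "x(p := x p + x q)"
      have "sum ?y (S - {q}) = 1"
      proof -
        have "sum ?y (S - {q}) = (x p + x q) + sum ?y (S - {q} - {p})"
          using psubset.hyps p \<open>p \<noteq> q\<close> by (simp add: sum.remove[of _ p])
        also have "sum ?y (S - {q} - {p}) = sum x (S - {q} - {p})"
          by (rule sum.cong) auto
        also have "(x p + x q) + \<dots> = sum x S"
          using psubset.hyps p q \<open>p \<noteq> q\<close> sum.remove[of S q x] sum.remove[of "S - {q}" p x]
          by simp
        finally show ?thesis using psubset.prems by simp
      qed
      moreover have "H_hom_free_on E (S - {q})"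
        using psubset.prems(1) unfolding H_hom_free_on_def by blast
      ultimately have "(\<Sum>e | e \<in> E \<and> e \<subseteq> S - {q}. prod ?y e) \<le> 1 / 27"
        using psubset.prems(2) p q by (intro psubset.IH) auto
      moreover have "{e. e \<in> E \<and> e \<subseteq> S - {q}} = {e. e \<in> F \<and> q \<notin> e}"
        by (auto simp: F_def)
      moreover have "(\<Sum>e\<in>F. prod x e) \<le> (\<Sum>e | e \<in> F \<and> q \<notin> e. prod ?y e)"
        using q psubset.prems(2) by (intro weight_shift F pq le \<open>p \<noteq> q\<close>) auto
      ultimately show ?thesis by simp
    qed
    have "(\<Sum>e\<in>F. prod x e) \<le> 1 / 27"
    proof (cases "?D v \<le> ?D u")
      case True
      then show ?thesis using shift[of u v] uv unc by blast
    next
      case False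
      then show ?thesis using shift[of v u] uv unc by fastforce
    qed
    then show ?thesis by (simp add: F_def)
  qed
qed

lemma H_hom_free_card_le:
  assumes unif: "\<And>e. e \<in> E \<Longrightarrow> card e = 3" and "finite S" "H_hom_free_on E S"
  shows "real (card {e \<in> E. e \<subseteq> S}) \<le> real (card S) ^ 3 / 27"
proof (cases "S = {}")
  case True
  then have none: "{e \<in> E. e \<subseteq> S} = {}" using unif by fastforce
  show ?thesis unfolding none by simp
next
  case False
  define k where "k = real (card S)"
  have k: "k > 0" using False assms(2) by (auto simp: k_def card_gt_0_iff)
  have "(\<Sum>e | e \<in> E \<and> e \<subseteq> S. prod (\<lambda>_. 1 / k) e) \<le> 1 / 27"
    using k by (intro H_hom_free_weight_le assms) (auto simp: k_def)
  moreover have "(\<Sum>e | e \<in> E \<and> e \<subseteq> S. prod (\<lambda>_. 1 / k) e) = (\<Sum>e | e \<in> E \<and> e \<subseteq> S. (1 / k) ^ 3)"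
    by (rule sum.cong) (auto simp: unif)
  ultimately have "real (card {e \<in> E. e \<subseteq> S}) / k ^ 3 \<le> 1 / 27"
    by (simp add: power_divide)
  then show ?thesis using k by (simp add: k_def[symmetric] field_simps)
qed

section \<open>Vertex doubling and the proper images of H\<close>

text \<open>
  Cauchy-Schwarz, read as a statement on doubling one vertex: if the relation \<open>R\<close> between a
  vertex and the tuple of remaining ones has density $p$, then its two-fold version, in which the
  chosen vertex has two copies, has density at least $p^2$.
\<close>

lemma card_duplicate:
  assumes "finite X" "finite V"
  shows "(card {(x,v). x \<in> X \<and> v \<in> V \<and> R x v})\<^sup>2
    \<le> card X * card {(x,v,w). x \<in> X \<and> v \<in> V \<and> w \<in> V \<and> R x v \<and> R x w}"
proof -
  define D where "D x = {v \<in> V. R x v}" for x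
  have fin: "finite (D x)" for x using assms(2) by (simp add: D_def)
  have "{(x,v). x \<in> X \<and> v \<in> V \<and> R x v} = Sigma X D" by (auto simp: D_def)
  then have 1: "card {(x,v). x \<in> X \<and> v \<in> V \<and> R x v} = (\<Sum>x\<in>X. card (D x))"
    using assms(1) fin by simp
  have "{(x,v,w). x \<in> X \<and> v \<in> V \<and> w \<in> V \<and> R x v \<and> R x w} = (SIGMA x:X. D x \<times> D x)"
    by (auto simp: D_def)
  then have 2: "card {(x,v,w). x \<in> X \<and> v \<in> V \<and> w \<in> V \<and> R x v \<and> R x w} = (\<Sum>x\<in>X. (card (D x))\<^sup>2)"
    using assms(1) fin by (simp add: card_cartesian_product power2_eq_square)
  have "(\<Sum>x\<in>X. real (card (D x)))\<^sup>2 \<le> (\<Sum>x\<in>X. (real (card (D x)))\<^sup>2) * real (card X)"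
    by (rule sum_squared_le_sum_of_squares)
  then have "real ((\<Sum>x\<in>X. card (D x))\<^sup>2) \<le> real (card X * (\<Sum>x\<in>X. (card (D x))\<^sup>2))"
    by (simp add: mult.commute)
  then show ?thesis unfolding 1 2 of_nat_le_iff .
qed

definition H_copy_free :: "'a set set \<Rightarrow> bool" where
  "H_copy_free E \<longleftrightarrow> (\<forall>a b c d e f. H_hom E a b c d e f \<longrightarrow> \<not> distinct [a,b,c,d,e,f])"

definition H_homs :: "'a set set \<Rightarrow> ('a \<times> 'a \<times> 'a \<times> 'a \<times> 'a \<times> 'a) set" where
  "H_homs E = {(a,b,c,d,e,f). H_hom E a b c d e f}"

text \<open>
  The proper images of $H$ that occur: identifying $5$ with $2$ makes $123$, $124$, $345$
  a $K_4^-$; otherwise $1, \<dots>, 5$ are distinct and $6$ is one of $2$, $3$, $4$. As the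
  exchange of $3$ and $4$ preserves the other edges, $6 = 2$ and $6 = 3$ suffice.
\<close>

definition K4_minus_sets :: "'a set set \<Rightarrow> 'a set set" where
  "K4_minus_sets E = {{a,b,c,d} | a b c d. {a,b,c} \<in> E \<and> {a,b,d} \<in> E \<and> {c,d,b} \<in> E}"

definition H_image5_sets :: "'a set set \<Rightarrow> 'a set set" where
  "H_image5_sets E = {{a,b,c,d,e} | a b c d e. b \<noteq> e \<and>
     {a,b,c} \<in> E \<and> {a,b,d} \<in> E \<and> {c,d,e} \<in> E \<and> ({a,e,b} \<in> E \<or> {a,e,c} \<in> E)}"

section \<open>Averaging over subsets of fixed size\<close>

lemma card_supersets:
  assumes "finite V" "T \<subseteq> V" "card T \<le> k"
  shows "card {S. S \<subseteq> V \<and> card S = k \<and> T \<subseteq> S} = (card V - card T) choose (k - card T)"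
proof -
  have fin: "finite T" "finite (V - T)" using assms by (auto intro: finite_subset)
  have "bij_betw (\<lambda>S. S - T) {S. S \<subseteq> V \<and> card S = k \<and> T \<subseteq> S} {U. U \<subseteq> V - T \<and> card U = k - card T}"
  proof (rule bij_betw_byWitness[where f' = "\<lambda>U. U \<union> T"])
    show "(\<lambda>S. S - T) ` {S. S \<subseteq> V \<and> card S = k \<and> T \<subseteq> S} \<subseteq> {U. U \<subseteq> V - T \<and> card U = k - card T}"
      using fin by (auto simp: card_Diff_subset)
    show "(\<lambda>U. U \<union> T) ` {U. U \<subseteq> V - T \<and> card U = k - card T} \<subseteq> {S. S \<subseteq> V \<and> card S = k \<and> T \<subseteq> S}"
    proof (clarsimp simp: assms(2))
      fix U assume U: "U \<subseteq> V - T" "card U = k - card T"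
      then have "finite U" "U \<inter> T = {}" using fin finite_subset by auto
      then have "card (U \<union> T) = k" using U(2) assms(3) fin by (simp add: card_Un_disjoint)
      then show "U \<subseteq> V \<and> card (U \<union> T) = k" using U(1) by blast
    qed
  qed auto
  then have "card {S. S \<subseteq> V \<and> card S = k \<and> T \<subseteq> S} = card {U. U \<subseteq> V - T \<and> card U = k - card T}"
    by (rule bij_betw_same_card)
  then show ?thesis
    using fin assms(2) by (simp add: n_subsets card_Diff_subset)
qed

text \<open>
  The right-hand side is the number of \<open>k\<close>-subsets times the density of \<open>F\<close> times the
  number of \<open>j\<close>-subsets of a \<open>k\<close>-set: a random \<open>k\<close>-subset sees the density of \<open>F\<close> on
  average.
\<close>

lemma average_over_subsets:
  assumes "finite V" "\<And>T. T \<in> F \<Longrightarrow> T \<subseteq> V \<and> card T = j" "j \<le> k" "k \<le> card V"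
  shows "(\<Sum>S | S \<subseteq> V \<and> card S = k. real (card {T \<in> F. T \<subseteq> S}))
    = real (card F) / real (card V choose j) * real (k choose j) * real (card V choose k)"
proof -
  have "finite F" using assms(1,2) by (intro finite_subset[of F "Pow V"]) auto
  moreover have "finite {S. S \<subseteq> V \<and> card S = k}" using assms(1) by simp
  moreover have "\<forall>T\<in>F. card {S \<in> {S. S \<subseteq> V \<and> card S = k}. T \<subseteq> S} = (card V - j) choose (k - j)"
    using card_supersets[OF assms(1)] assms(2,3) by (simp add: conj_assoc)
  ultimately have "(\<Sum>S | S \<subseteq> V \<and> card S = k. card {T \<in> F. T \<subseteq> S})
      = (\<Sum>T\<in>F. (card V - j) choose (k - j))"
    by (intro sum_multicount_gen)
  then have "(\<Sum>S | S \<subseteq> V \<and> card S = k. real (card {T \<in> F. T \<subseteq> S}))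
      = real (card F) * real ((card V - j) choose (k - j))"
    by (simp flip: of_nat_sum of_nat_mult)
  moreover have "real (card V choose k) * real (k choose j) = real (card V choose j) * real ((card V - j) choose (k - j))"
    using choose_mult[OF assms(3,4)] by (simp flip: of_nat_mult)
  moreover have "real (card V choose j) > 0" using assms(3,4) by simp
  ultimately show ?thesis by (simp add: field_simps)
qed

section \<open>Counting in a 3-graph without a copy of H\<close>

context
  fixes V :: "'a set" and E :: "'a set set"
  assumes fin: "finite V" and sub: "\<And>e. e \<in> E \<Longrightarrow> e \<subseteq> V" and unif: "\<And>e. e \<in> E \<Longrightarrow> card e = 3"
    and cfree: "H_copy_free E"
begin

lemma edge_distinct: "{a,b,c} \<in> E \<Longrightarrow> a \<noteq> b \<and> a \<noteq> c \<and> b \<noteq> c"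
  using unif triple_distinct by metis

lemma edge_verts: "{a,b,c} \<in> E \<Longrightarrow> a \<in> V \<and> b \<in> V \<and> c \<in> V"
  using sub by blast

text \<open>
  These four pairs are the only ones that lie in no common edge of $H$.
\<close>

lemma H_hom_coincidence:
  assumes "H_hom E a b c d e f"
  shows "e = b \<or> f = b \<or> f = c \<or> f = d"
proof -
  have "\<not> distinct [a,b,c,d,e,f]" using assms cfree unfolding H_copy_free_def by blast
  moreover have "a \<noteq> b" "a \<noteq> c" "b \<noteq> c" "a \<noteq> d" "b \<noteq> d" "c \<noteq> d" "c \<noteq> e" "d \<noteq> e" "a \<noteq> e" "a \<noteq> f" "e \<noteq> f"
    using assms edge_distinct unfolding H_hom_def by blast+
  ultimately show ?thesis by auto
qed

lemma H_hom_verts: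
  assumes "H_hom E a b c d e f"
  shows "a \<in> V" "b \<in> V" "c \<in> V" "d \<in> V" "e \<in> V" "f \<in> V"
  using assms edge_verts unfolding H_hom_def by blast+

lemma H_homs_finite: "finite (H_homs E)"
proof (rule finite_subset)
  show "H_homs E \<subseteq> V \<times> V \<times> V \<times> V \<times> V \<times> V"
    using H_hom_verts by (auto simp: H_homs_def)
qed (use fin in simp)

lemma card_H_homs_le: "card (H_homs E) \<le> 4 * card V ^ 5"
proof -
  let ?X = "V \<times> V \<times> V \<times> V \<times> V"
  have X: "finite ?X" "card ?X = card V ^ 5"
    using fin by (auto simp: card_cartesian_product eval_nat_numeral)
  let ?A = "(\<lambda>(a,b,c,d,f). (a,b,c,d,b,f)) ` ?X" and ?B = "(\<lambda>(a,b,c,d,e). (a,b,c,d,e,b)) ` ?X"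
    and ?C = "(\<lambda>(a,b,c,d,e). (a,b,c,d,e,c)) ` ?X" and ?D = "(\<lambda>(a,b,c,d,e). (a,b,c,d,e,d)) ` ?X"
  have "H_homs E \<subseteq> ?A \<union> ?B \<union> ?C \<union> ?D"
  proof
    fix t assume "t \<in> H_homs E"
    then obtain a b c d e f where t: "t = (a,b,c,d,e,f)" and h: "H_hom E a b c d e f"
      unfolding H_homs_def by blast
    show "t \<in> ?A \<union> ?B \<union> ?C \<union> ?D"
      unfolding t using H_hom_coincidence[OF h] H_hom_verts[OF h] by (auto simp: image_iff)
  qed
  then have "card (H_homs E) \<le> card (?A \<union> ?B \<union> ?C \<union> ?D)"
    using X(1) by (intro card_mono) auto
  also have "\<dots> \<le> card ?A + card ?B + card ?C + card ?D"
    by (intro order_trans[OF card_Un_le] add_mono order_refl)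
  also have "\<dots> \<le> card ?X + card ?X + card ?X + card ?X"
    by (intro add_mono card_image_le X)
  finally show ?thesis by (simp only: X)
qed

text \<open>
  The doubled relation consists of homomorphisms from $H$, up to the order \<open>g\<close> of the
  coordinates, so it has $O(n^5)$ elements and Cauchy-Schwarz makes \<open>R\<close> sparse.
\<close>

lemma card_duplicate_H_homs:
  assumes R: "\<And>x v w. R x v \<Longrightarrow> R x w \<Longrightarrow> g (x,v,w) \<in> H_homs E" and "inj g"
  shows "(card {(x,v). x \<in> V \<times> V \<times> V \<times> V \<and> v \<in> V \<and> R x v})\<^sup>2 \<le> 4 * card V ^ 9"
proof -
  let ?X = "V \<times> V \<times> V \<times> V"
  have X: "finite ?X" "card ?X = card V ^ 4"
    using fin by (auto simp: card_cartesian_product eval_nat_numeral)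
  have "card {(x,v,w). x \<in> ?X \<and> v \<in> V \<and> w \<in> V \<and> R x v \<and> R x w} \<le> 4 * card V ^ 5"
    using R by (intro order_trans[OF card_inj_on_le[OF inj_on_subset[OF \<open>inj g\<close>]] card_H_homs_le]
        H_homs_finite) auto
  then have "(card {(x,v). x \<in> ?X \<and> v \<in> V \<and> R x v})\<^sup>2 \<le> card V ^ 4 * (4 * card V ^ 5)"
    by (rule order_trans[OF card_duplicate[OF X(1) fin, of R, unfolded X(2)] mult_le_mono2])
  then show ?thesis by (simp flip: power_add add: mult.left_commute)
qed

text \<open>
  Two doublings lead from $K_4^-$ to $H$: in the edges $123$, $124$, $342$, a copy of
  $3$ provides the vertex $6$ in a new edge $126$, and then a copy of $2$ provides the
  vertex $5$, turning $342$ and $126$ into $345$ and $156$.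
\<close>

lemma card_K4_minus_sets_le: "card (K4_minus_sets E) ^ 4 \<le> 4 * card V ^ 15"
proof -
  define R where "R = (\<lambda>(a,b,d) c. {a,b,c} \<in> E \<and> {a,b,d} \<in> E \<and> {c,d,b} \<in> E)"
  define R' where "R' = (\<lambda>(a,c,d,f) b. {a,b,c} \<in> E \<and> {a,b,d} \<in> E \<and> {c,d,b} \<in> E \<and> {a,b,f} \<in> E)"
  let ?X = "V \<times> V \<times> V" and ?Y = "V \<times> V \<times> V \<times> V"
  let ?K = "{(x,v). x \<in> ?X \<and> v \<in> V \<and> R x v}"
  let ?L = "{(x,v). x \<in> ?Y \<and> v \<in> V \<and> R' x v}"
  have X: "finite ?X" "card ?X = card V ^ 3"
    using fin by (auto simp: card_cartesian_product eval_nat_numeral)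
  have finK: "finite ?K" by (rule finite_subset[of _ "?X \<times> V"]) (use fin in auto)
  have finL: "finite ?L" by (rule finite_subset[of _ "?Y \<times> V"]) (use fin in auto)
  have "K4_minus_sets E \<subseteq> (\<lambda>((a,b,d),c). {a,b,c,d}) ` ?K"
  proof (clarsimp simp: K4_minus_sets_def)
    fix a b c d assume h: "{a,b,c} \<in> E" "{a,b,d} \<in> E" "{c,d,b} \<in> E"
    then have "((a,b,d),c) \<in> ?K" using edge_verts by (auto simp: R_def)
    then show "{a,b,c,d} \<in> (\<lambda>((a,b,d),c). {a,b,c,d}) ` ?K" by (rule rev_image_eqI) simp
  qed
  then have "card (K4_minus_sets E) \<le> card ?K"
    using finK by (meson card_image_le card_mono finite_imageI order_trans)
  then have "card (K4_minus_sets E) ^ 4 \<le> card ?K ^ 4" by (rule power_mono) simp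
  also have "\<dots> = ((card ?K)\<^sup>2)\<^sup>2" by simp
  also have "\<dots> \<le> (card V ^ 3 * card ?L)\<^sup>2"
  proof (rule power_mono)
    have "card {(x,v,w). x \<in> ?X \<and> v \<in> V \<and> w \<in> V \<and> R x v \<and> R x w} \<le> card ?L"
    proof (rule card_inj_on_le[OF _ _ finL])
      let ?h = "\<lambda>((a,b,d),c,f). ((a,c,d,f),b)"
      show "inj_on ?h {(x,v,w). x \<in> ?X \<and> v \<in> V \<and> w \<in> V \<and> R x v \<and> R x w}"
        by (rule inj_on_subset[of _ UNIV]) (auto simp: inj_def)
      show "?h ` {(x,v,w). x \<in> ?X \<and> v \<in> V \<and> w \<in> V \<and> R x v \<and> R x w} \<subseteq> ?L"
        by (auto simp: R_def R'_def)
    qed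
    then show "(card ?K)\<^sup>2 \<le> card V ^ 3 * card ?L"
      by (rule order_trans[OF card_duplicate[OF X(1) fin, of R, unfolded X(2)] mult_le_mono2])
  qed simp
  also have "\<dots> = card V ^ 6 * (card ?L)\<^sup>2" by (simp add: power_mult_distrib flip: power_mult)
  also have "\<dots> \<le> card V ^ 6 * (4 * card V ^ 9)"
    by (intro mult_le_mono2 card_duplicate_H_homs[of _ "\<lambda>((a,c,d,f),b,e). (a,b,c,d,e,f)"])
      (auto simp: R'_def H_homs_def H_hom_def inj_def)
  finally show ?thesis by (simp flip: power_add add: mult.left_commute)
qed

text \<open>
  Here one doubling is enough: a copy of the vertex with which $6$ was identified plays the role of
  $6$.
\<close>

lemma card_H_image5_sets_le: "(card (H_image5_sets E))\<^sup>2 \<le> 16 * card V ^ 9"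
proof -
  define R where "R = (\<lambda>(a,c,d,e) b. {a,b,c} \<in> E \<and> {a,b,d} \<in> E \<and> {c,d,e} \<in> E \<and> {a,e,b} \<in> E)"
  define R' where "R' = (\<lambda>(a,b,d,e) c. {a,b,c} \<in> E \<and> {a,b,d} \<in> E \<and> {c,d,e} \<in> E \<and> {a,e,c} \<in> E)"
  let ?Y = "V \<times> V \<times> V \<times> V"
  let ?K = "{(x,v). x \<in> ?Y \<and> v \<in> V \<and> R x v}"
  let ?L = "{(x,v). x \<in> ?Y \<and> v \<in> V \<and> R' x v}"
  have finK: "finite ?K" by (rule finite_subset[of _ "?Y \<times> V"]) (use fin in auto)
  have finL: "finite ?L" by (rule finite_subset[of _ "?Y \<times> V"]) (use fin in auto)
  let ?f = "\<lambda>((a,c,d,e),b). {a,b,c,d,e}" and ?g = "\<lambda>((a,b,d,e),c). {a,b,c,d,e}"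
  have "H_image5_sets E \<subseteq> ?f ` ?K \<union> ?g ` ?L"
  proof
    fix T assume "T \<in> H_image5_sets E"
    then obtain a b c d e where T: "T = {a,b,c,d,e}"
      and h: "{a,b,c} \<in> E" "{a,b,d} \<in> E" "{c,d,e} \<in> E" "{a,e,b} \<in> E \<or> {a,e,c} \<in> E"
      unfolding H_image5_sets_def by blast
    have "((a,c,d,e),b) \<in> ?K \<or> ((a,b,d,e),c) \<in> ?L"
      using h edge_verts by (auto simp: R_def R'_def)
    then show "T \<in> ?f ` ?K \<union> ?g ` ?L"
    proof
      assume "((a,c,d,e),b) \<in> ?K"
      then have "T \<in> ?f ` ?K" by (rule rev_image_eqI) (simp add: T)
      then show ?thesis by blast
    next
      assume "((a,b,d,e),c) \<in> ?L"
      then have "T \<in> ?g ` ?L" by (rule rev_image_eqI) (simp add: T)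
      then show ?thesis by blast
    qed
  qed
  then have "card (H_image5_sets E) \<le> card (?f ` ?K \<union> ?g ` ?L)"
    using finK finL by (intro card_mono) auto
  also have "\<dots> \<le> card ?K + card ?L"
    by (intro order_trans[OF card_Un_le] add_mono card_image_le finK finL)
  finally have "(card (H_image5_sets E))\<^sup>2 \<le> (card ?K + card ?L)\<^sup>2" by (rule power_mono) simp
  also have "\<dots> \<le> 2 * (card ?K)\<^sup>2 + 2 * (card ?L)\<^sup>2"
  proof -
    have "(real p + real q)\<^sup>2 \<le> 2 * (real p)\<^sup>2 + 2 * (real q)\<^sup>2" for p q :: nat
      using zero_le_power2[of "real p - real q"] by (simp add: power2_eq_square algebra_simps)
    from this[of "card ?K" "card ?L"] show ?thesis
      unfolding of_nat_add[symmetric] of_nat_power[symmetric] of_nat_le_iff[symmetric, where 'a = real]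
      by simp
  qed
  also have "\<dots> \<le> 2 * (4 * card V ^ 9) + 2 * (4 * card V ^ 9)"
  proof (intro add_mono mult_le_mono2)
    show "(card ?K)\<^sup>2 \<le> 4 * card V ^ 9"
      by (intro card_duplicate_H_homs[of _ "\<lambda>((a,c,d,e),b,f). (a,b,c,d,e,f)"])
        (auto simp: R_def H_homs_def H_hom_def inj_def)
    show "(card ?L)\<^sup>2 \<le> 4 * card V ^ 9"
      by (intro card_duplicate_H_homs[of _ "\<lambda>((a,b,d,e),c,f). (a,b,c,d,e,f)"])
        (auto simp: R'_def H_homs_def H_hom_def inj_def)
  qed
  finally show ?thesis by simp
qed

lemma card_K4_minus_set:
  assumes "T \<in> K4_minus_sets E"
  shows "T \<subseteq> V \<and> card T = 4"
proof -
  obtain a b c d where T: "T = {a,b,c,d}" and h: "{a,b,c} \<in> E" "{a,b,d} \<in> E" "{c,d,b} \<in> E"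
    using assms unfolding K4_minus_sets_def by blast
  have "distinct [a,b,c,d]" using h[THEN edge_distinct] by simp
  then have "card T = 4" unfolding T by simp
  moreover have "T \<subseteq> V" unfolding T using h[THEN edge_verts] by simp
  ultimately show ?thesis by blast
qed

lemma card_H_image5_set:
  assumes "T \<in> H_image5_sets E"
  shows "T \<subseteq> V \<and> card T = 5"
proof -
  obtain a b c d e where T: "T = {a,b,c,d,e}" and "b \<noteq> e"
    and h: "{a,b,c} \<in> E" "{a,b,d} \<in> E" "{c,d,e} \<in> E" and "{a,e,b} \<in> E \<or> {a,e,c} \<in> E"
    using assms unfolding H_image5_sets_def by blast
  then have "a \<noteq> e" using edge_distinct by blast
  then have "distinct [a,b,c,d,e]" using h[THEN edge_distinct] \<open>b \<noteq> e\<close> by simp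
  then have "card T = 5" unfolding T by simp
  moreover have "T \<subseteq> V" unfolding T using h[THEN edge_verts] by simp
  ultimately show ?thesis by blast
qed

lemma not_H_hom_free_on_cases:
  assumes "\<not> H_hom_free_on E S"
  obtains T where "T \<subseteq> S" "T \<in> K4_minus_sets E \<or> T \<in> H_image5_sets E"
proof -
  obtain a b c d e f where S: "a \<in> S" "b \<in> S" "c \<in> S" "d \<in> S" "e \<in> S"
    and h: "H_hom E a b c d e f"
    using assms unfolding H_hom_free_on_def by blast
  have h': "{a,b,c} \<in> E" "{a,b,d} \<in> E" "{c,d,e} \<in> E" "{a,e,f} \<in> E"
    using h by (auto simp: H_hom_def)
  consider "e = b" | "e \<noteq> b" "f = b \<or> f = c" | "e \<noteq> b" "f = d"
    using H_hom_coincidence[OF h] by blast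
  then show thesis
  proof cases
    case 1
    then have "{c,d,b} \<in> E" using h'(3) by simp
    then have "{a,b,c,d} \<in> K4_minus_sets E" using h'(1,2) unfolding K4_minus_sets_def by blast
    then show thesis using S that[of "{a,b,c,d}"] by blast
  next
    case 2
    then have "{a,b,c,d,e} \<in> H_image5_sets E" using h' unfolding H_image5_sets_def by blast
    then show thesis using S that[of "{a,b,c,d,e}"] by blast
  next
    case 3
    then have "b \<noteq> e" "{a,e,d} \<in> E" "{d,c,e} \<in> E"
      using h' by (simp_all add: insert_commute[of d c])
    with h'(1,2) have "{a,b,d,c,e} \<in> H_image5_sets E" unfolding H_image5_sets_def by blast
    then show thesis using S that[of "{a,b,d,c,e}"] by blast
  qed
qed

text \<open>
  Average the number of edges inside a \<open>k\<close>-subset \<open>S\<close>. If \<open>S\<close> is hom-free, there are at most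
  $k^3/27$ of them. Otherwise \<open>S\<close> contains a bad set of size $4$ or $5$, and the trivial bound
  ${k \choose 3}$ is charged to the bad sets in \<open>S\<close>.
\<close>

lemma edge_density_le:
  assumes k: "5 \<le> k" "k \<le> card V"
  shows "real (card E) / real (card V choose 3) * real (k choose 3) \<le> real k ^ 3 / 27 + real (k choose 3) *
    (real (card (K4_minus_sets E)) / real (card V choose 4) * real (k choose 4)
     + real (card (H_image5_sets E)) / real (card V choose 5) * real (k choose 5))"
proof -
  let ?P = "{S. S \<subseteq> V \<and> card S = k}"
  define N where "N F S = real (card {T \<in> F. T \<subseteq> S})" for F :: "'a set set" and S
  define C where "C = real (card V choose k)"
  have P: "finite ?P" "real (card ?P) = C" using fin by (auto simp: n_subsets C_def)
  have C: "C > 0" using k by (simp add: C_def)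
  have finite_bad: "finite (K4_minus_sets E)" "finite (H_image5_sets E)"
    using fin card_K4_minus_set card_H_image5_set by (auto intro!: finite_subset[of _ "Pow V"])
  have local_bound: "N E S \<le> real k ^ 3 / 27 + real (k choose 3) * (N (K4_minus_sets E) S + N (H_image5_sets E) S)"
    if "S \<in> ?P" for S
  proof -
    have S: "finite S" "card S = k" using that fin finite_subset by auto
    show ?thesis
    proof (cases "H_hom_free_on E S")
      case True
      then have "N E S \<le> real k ^ 3 / 27"
        using H_hom_free_card_le[OF unif S(1)] S(2) by (simp add: N_def)
      then show ?thesis by (simp add: N_def add_increasing2)
    next
      case False
      then obtain T where T: "T \<subseteq> S" "T \<in> K4_minus_sets E \<or> T \<in> H_image5_sets E"
        by (rule not_H_hom_free_on_cases)
      then have "card {T \<in> K4_minus_sets E. T \<subseteq> S} > 0 \<or> card {T \<in> H_image5_sets E. T \<subseteq> S} > 0"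
        using finite_bad by (auto simp: card_gt_0_iff)
      then have one: "1 \<le> N (K4_minus_sets E) S + N (H_image5_sets E) S"
        unfolding N_def by linarith
      have "card {e \<in> E. e \<subseteq> S} \<le> card {e. e \<subseteq> S \<and> card e = 3}"
        using S(1) unif by (intro card_mono) auto
      then have "N E S \<le> real (k choose 3) * 1" using S by (simp add: N_def n_subsets)
      also have "\<dots> \<le> real (k choose 3) * (N (K4_minus_sets E) S + N (H_image5_sets E) S)"
        by (rule mult_left_mono[OF one]) simp
      finally show ?thesis by (simp add: add_increasing)
    qed
  qed
  have "real (card E) / real (card V choose 3) * real (k choose 3) * C = (\<Sum>S\<in>?P. N E S)"
    unfolding N_def C_def
    using k sub unif by (intro average_over_subsets[OF fin, symmetric]) auto
  also have "\<dots> \<le> (\<Sum>S\<in>?P. real k ^ 3 / 27 + real (k choose 3) * (N (K4_minus_sets E) S + N (H_image5_sets E) S))"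
    by (rule sum_mono) (rule local_bound)
  also have "\<dots> = C * (real k ^ 3 / 27)
      + real (k choose 3) * ((\<Sum>S\<in>?P. N (K4_minus_sets E) S) + (\<Sum>S\<in>?P. N (H_image5_sets E) S))"
    unfolding sum.distrib sum_distrib_left[symmetric] sum_constant P(2) ..
  also have "(\<Sum>S\<in>?P. N (K4_minus_sets E) S) = real (card (K4_minus_sets E)) / real (card V choose 4) * real (k choose 4) * C"
    unfolding N_def C_def
    using k card_K4_minus_set by (intro average_over_subsets[OF fin]) auto
  also have "(\<Sum>S\<in>?P. N (H_image5_sets E) S) = real (card (H_image5_sets E)) / real (card V choose 5) * real (k choose 5) * C"
    unfolding N_def C_def
    using k card_H_image5_set by (intro average_over_subsets[OF fin]) auto
  finally have "real (card E) / real (card V choose 3) * real (k choose 3) * C \<le> (real k ^ 3 / 27 + real (k choose 3) *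
    (real (card (K4_minus_sets E)) / real (card V choose 4) * real (k choose 4)
     + real (card (H_image5_sets E)) / real (card V choose 5) * real (k choose 5))) * C"
    by (simp add: algebra_simps)
  then show ?thesis by (rule mult_right_le_imp_le[OF _ C])
qed

text \<open>
  As $n$ grows, this and the next bound tend to $0$, which is all that matters about them.
  The constants come from ${n \choose j} \<ge> (n/j)^j$.
\<close>

lemma K4_minus_density_le:
  assumes "4 \<le> card V"
  shows "real (card (K4_minus_sets E)) / real (card V choose 4) \<le> sqrt (sqrt (4 ^ 17 / real (card V)))"
proof -
  define n where "n = real (card V)"
  have n: "n > 0" using assms by (simp add: n_def)
  let ?r = "real (card (K4_minus_sets E)) / real (card V choose 4)"
  have "?r \<le> real (card (K4_minus_sets E)) / (n / 4) ^ 4"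
    using binomial_ge_n_over_k_pow_k[OF assms, where 'a = real] n assms
    by (intro divide_left_mono mult_pos_pos) (auto simp: n_def)
  then have "?r ^ 4 \<le> (real (card (K4_minus_sets E)) / (n / 4) ^ 4) ^ 4" by (rule power_mono) simp
  also have "\<dots> = real (card (K4_minus_sets E) ^ 4) * 4 ^ 16 / n ^ 16"
    by (simp add: power_divide flip: power_mult)
  also have "\<dots> \<le> real (4 * card V ^ 15) * 4 ^ 16 / n ^ 16"
    using n by (intro divide_right_mono mult_right_mono of_nat_mono card_K4_minus_sets_le) simp_all
  also have "\<dots> = (4 * n ^ 15) * 4 ^ 16 / (n * n ^ 15)"
    by (simp add: n_def flip: power_Suc)
  also have "\<dots> = 4 ^ 17 / n" using n by simp
  finally have "(?r\<^sup>2)\<^sup>2 \<le> 4 ^ 17 / n" by simp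
  then have "?r\<^sup>2 \<le> sqrt (4 ^ 17 / n)" by (rule real_le_rsqrt)
  then show ?thesis unfolding n_def by (rule real_le_rsqrt)
qed

lemma H_image5_density_le:
  assumes "5 \<le> card V"
  shows "real (card (H_image5_sets E)) / real (card V choose 5) \<le> sqrt (16 * 5 ^ 10 / real (card V))"
proof -
  define n where "n = real (card V)"
  have n: "n > 0" using assms by (simp add: n_def)
  let ?r = "real (card (H_image5_sets E)) / real (card V choose 5)"
  have "?r \<le> real (card (H_image5_sets E)) / (n / 5) ^ 5"
    using binomial_ge_n_over_k_pow_k[OF assms, where 'a = real] n assms
    by (intro divide_left_mono mult_pos_pos) (auto simp: n_def)
  then have "?r\<^sup>2 \<le> (real (card (H_image5_sets E)) / (n / 5) ^ 5)\<^sup>2" by (rule power_mono) simp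
  also have "\<dots> = real ((card (H_image5_sets E))\<^sup>2) * 5 ^ 10 / n ^ 10"
    by (simp add: power_divide flip: power_mult)
  also have "\<dots> \<le> real (16 * card V ^ 9) * 5 ^ 10 / n ^ 10"
    using n by (intro divide_right_mono mult_right_mono of_nat_mono card_H_image5_sets_le) simp_all
  also have "\<dots> = (16 * n ^ 9) * 5 ^ 10 / (n * n ^ 9)"
    by (simp add: n_def flip: power_Suc)
  also have "\<dots> = 16 * 5 ^ 10 / n" using n by simp
  finally show ?thesis unfolding n_def by (rule real_le_rsqrt)
qed

end

section \<open>The upper bound\<close>

lemma family_free_H_graph_imp_H_copy_free:
  assumes G: "three_graph (V, E)" and free: "family_free {H_graph} (V, E)"
  shows "H_copy_free E"
  unfolding H_copy_free_def
proof (intro allI impI notI)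
  fix a b c d e f assume h: "H_hom E a b c d e f" and dist: "distinct [a,b,c,d,e,f]"
  define \<phi> where "\<phi> i = [a,b,c,d,e,f] ! (i - 1)" for i :: nat
  have phi: "\<phi> 1 = a" "\<phi> (Suc 0) = a" "\<phi> 2 = b" "\<phi> 3 = c" "\<phi> 4 = d" "\<phi> 5 = e" "\<phi> 6 = f"
    by (simp_all add: \<phi>_def)
  have six: "{1..6} = {1,2,3,4,5,6::nat}" by auto
  let ?G' = "({a,b,c,d,e,f}, {{a,b,c}, {a,b,d}, {c,d,e}, {a,e,f}})"
  have "bij_betw \<phi> {1..6} {a,b,c,d,e,f}"
    unfolding bij_betw_def six using dist by (auto simp: inj_on_def phi)
  then have "hisomorphic H_graph ?G'"
    unfolding hisomorphic_def H_graph_def by (intro exI[of _ \<phi>]) (simp add: phi)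
  moreover have "hsubgraph ?G' (V, E)"
    using G h dist unfolding hsubgraph_def three_graph_def H_hom_def by auto
  ultimately show False using free unfolding family_free_def by blast
qed

lemma cube_over_choose_3_tendsto: "(\<lambda>n. real n ^ 3 / real (n choose 3)) \<longlonglongrightarrow> 6"
proof -
  have "(\<lambda>n. 6 / ((1 - inverse (real n)) * (1 - 2 * inverse (real n)))) \<longlonglongrightarrow> 6 / ((1 - 0) * (1 - 2 * 0))"
    by (intro tendsto_intros lim_inverse_n) auto
  moreover have "eventually (\<lambda>n. 6 / ((1 - inverse (real n)) * (1 - 2 * inverse (real n)))
      = real n ^ 3 / real (n choose 3)) sequentially"
    using eventually_ge_at_top[of 3]
  proof eventually_elim
    case (elim n)
    have "real (n choose 3) = (\<Prod>i = 0..<3. real (n - i) / real (3 - i))"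
      using elim by (rule binomial_altdef_of_nat)
    also have "\<dots> = real n * (real n - 1) * (real n - 2) / 6"
      using elim by (simp add: numeral_3_eq_3 of_nat_diff)
    finally have choose: "real (n choose 3) = real n * (real n - 1) * (real n - 2) / 6" .
    have "6 / ((1 - inverse t) * (1 - 2 * inverse t)) = t ^ 3 / (t * (t - 1) * (t - 2) / 6)"
      if "t \<ge> 3" for t :: real
    proof -
      have "1 - inverse t = (t - 1) / t" "1 - 2 * inverse t = (t - 2) / t"
        using that by (auto simp: field_simps)
      then show ?thesis using that by (simp add: power3_eq_cube)
    qed
    from this[of "real n"] show ?case using elim by (simp add: choose)
  qed
  ultimately show ?thesis by (simp add: tendsto_cong)
qed

lemma turan_density_H_graph_LIMSEQ:
  "(\<lambda>n. real (ex_number n {H_graph}) / real (n choose 3)) \<longlonglongrightarrow> turan_density {H_graph}"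
  by (rule turan_density_LIMSEQ) (simp add: H_graph_def)

lemma ex_number_H_graph_le:
  assumes k: "5 \<le> k" "k \<le> n"
  shows "real (ex_number n {H_graph}) / real (n choose 3) * real (k choose 3) \<le> real k ^ 3 / 27
    + real (k choose 3) * (sqrt (sqrt (4 ^ 17 / real n)) * real (k choose 4)
      + sqrt (16 * 5 ^ 10 / real n) * real (k choose 5))"
proof -
  have "ex_candidates n {H_graph} \<noteq> {}"
    by (rule ex_candidates_nonempty) (simp add: H_graph_def)
  then have "ex_number n {H_graph} \<in> ex_candidates n {H_graph}"
    unfolding ex_number_def by (rule Max_in[OF ex_candidates_finite])
  then obtain V E where G: "three_graph (V, E)" "family_free {H_graph} (V, E)"
    and V: "card V = n" and ex: "ex_number n {H_graph} = card (E :: nat set set)"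
    by (auto simp: ex_candidates_def)
  have E: "finite V" "\<And>e. e \<in> E \<Longrightarrow> e \<subseteq> V" "\<And>e. e \<in> E \<Longrightarrow> card e = 3" "H_copy_free E"
    using G family_free_H_graph_imp_H_copy_free by (auto simp: three_graph_def)
  have "real (card E) / real (n choose 3) * real (k choose 3) \<le> real k ^ 3 / 27 + real (k choose 3) *
    (real (card (K4_minus_sets E)) / real (n choose 4) * real (k choose 4)
     + real (card (H_image5_sets E)) / real (n choose 5) * real (k choose 5))"
    using edge_density_le[OF E, of k] k V by simp
  also have "\<dots> \<le> real k ^ 3 / 27 + real (k choose 3) *
      (sqrt (sqrt (4 ^ 17 / real n)) * real (k choose 4)
       + sqrt (16 * 5 ^ 10 / real n) * real (k choose 5))"
    using K4_minus_density_le[OF E] H_image5_density_le[OF E] k V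
    by (intro add_left_mono mult_left_mono add_mono mult_right_mono) auto
  finally show ?thesis by (simp only: ex)
qed

lemma turan_density_H_graph_le: "turan_density {H_graph} \<le> 2 / 9"
proof -
  \<comment> \<open>Let \<open>n\<close> tend to infinity for fixed \<open>k\<close>, and only then \<open>k\<close>.\<close>
  have bound: "turan_density {H_graph} \<le> real k ^ 3 / real (k choose 3) / 27" if k: "5 \<le> k" for k
  proof -
    have "turan_density {H_graph} * real (k choose 3) \<le> real k ^ 3 / 27
      + real (k choose 3) * (sqrt (sqrt 0) * real (k choose 4) + sqrt 0 * real (k choose 5))"
    proof (rule LIMSEQ_le[OF tendsto_mult_right[OF turan_density_H_graph_LIMSEQ]])
      show "(\<lambda>n. real k ^ 3 / 27 + real (k choose 3) * (sqrt (sqrt (4 ^ 17 / real n)) * real (k choose 4)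
          + sqrt (16 * 5 ^ 10 / real n) * real (k choose 5)))
        \<longlonglongrightarrow> real k ^ 3 / 27
          + real (k choose 3) * (sqrt (sqrt 0) * real (k choose 4) + sqrt 0 * real (k choose 5))"
        by (intro tendsto_intros lim_const_over_n)
    qed (use ex_number_H_graph_le[OF k] in blast)
    moreover have "real (k choose 3) > 0" using k by simp
    ultimately show ?thesis by (simp add: field_simps)
  qed
  have "(\<lambda>k. real k ^ 3 / real (k choose 3) / 27) \<longlonglongrightarrow> 6 / 27"
    by (intro tendsto_divide cube_over_choose_3_tendsto tendsto_const) simp
  then have "turan_density {H_graph} \<le> 6 / 27"
    by (rule LIMSEQ_le_const) (use bound in blast)
  then show ?thesis by simp
qed

section \<open>The lower bound\<close>

text \<open>
  The parts are the residue classes modulo $3$.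
\<close>

definition residue_tripartite :: "nat \<Rightarrow> nat hgraph" where
  "residue_tripartite m = ({..<3 * m}, (\<lambda>(x,y,z). {3 * x, 3 * y + 1, 3 * z + 2}) ` ({..<m} \<times> {..<m} \<times> {..<m}))"

lemma card_residue_tripartite: "card (hedges (residue_tripartite m)) = m ^ 3"
proof -
  let ?g = "\<lambda>(x,y,z). {3 * x, 3 * y + 1, 3 * z + 2 :: nat}"
  have triple_inj: "x = x' \<and> y = y' \<and> z = z'"
    if eq: "{3 * x, 3 * y + 1, 3 * z + 2} = {3 * x', 3 * y' + 1, 3 * z' + 2 :: nat}" for x y z x' y' z'
  proof -
    have "3 * x \<in> {3 * x', 3 * y' + 1, 3 * z' + 2}" using eq by blast
    then have "3 * x = 3 * x' \<or> 3 * x = 3 * y' + 1 \<or> 3 * x = 3 * z' + 2" by blast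
    then have x: "x = x'" by presburger
    have "3 * y + 1 \<in> {3 * x', 3 * y' + 1, 3 * z' + 2}" using eq by blast
    then have "3 * y + 1 = 3 * x' \<or> 3 * y + 1 = 3 * y' + 1 \<or> 3 * y + 1 = 3 * z' + 2" by blast
    then have y: "y = y'" by presburger
    have "3 * z + 2 \<in> {3 * x', 3 * y' + 1, 3 * z' + 2}" using eq by blast
    then have "3 * z + 2 = 3 * x' \<or> 3 * z + 2 = 3 * y' + 1 \<or> 3 * z + 2 = 3 * z' + 2" by blast
    then have z: "z = z'" by presburger
    show ?thesis using x y z by blast
  qed
  have "inj ?g"
  proof (rule injI)
    fix s t assume eq: "?g s = ?g t"
    obtain x y z where s: "s = (x,y,z)" by (rule prod_cases3)
    obtain x' y' z' where t: "t = (x',y',z')" by (rule prod_cases3)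
    show "s = t" unfolding s t prod.inject by (rule triple_inj) (use eq in \<open>simp only: s t prod.case\<close>)
  qed
  then have "card (?g ` ({..<m} \<times> {..<m} \<times> {..<m})) = card ({..<m} \<times> {..<m} \<times> {..<m})"
    by (rule card_image[OF inj_on_subset[OF _ subset_UNIV]])
  then show ?thesis
    by (simp add: residue_tripartite_def card_cartesian_product power3_eq_cube)
qed

lemma residue_tripartite_rainbow:
  assumes "{p,q,r} \<in> hedges (residue_tripartite m)"
  shows "p mod 3 \<noteq> q mod 3" "p mod 3 \<noteq> r mod 3" "q mod 3 \<noteq> r mod 3"
proof -
  obtain x y z where "{p,q,r} = {3 * x, 3 * y + 1, 3 * z + 2}"
    using assms by (auto simp: residue_tripartite_def)
  then have "(\<lambda>v. v mod 3) ` {p,q,r} = (\<lambda>v. v mod 3) ` {3 * x, 3 * y + 1, 3 * z + 2}" by simp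
  then have "{p mod 3, q mod 3, r mod 3} = {0, 1, 2}" by (simp add: mod_Suc numeral_2_eq_2)
  then have "card {p mod 3, q mod 3, r mod 3} = 3" by simp
  from triple_distinct[OF this] show "p mod 3 \<noteq> q mod 3" "p mod 3 \<noteq> r mod 3" "q mod 3 \<noteq> r mod 3" .
qed

text \<open>
  Residues in an edge are distinct and hence sum to $3$. So $123$ and $124$ give $3$ and
  $4$ the same residue, which contradicts $345$.
\<close>

lemma family_free_residue_tripartite: "family_free {H_graph} (residue_tripartite m)"
  unfolding family_free_def
proof (clarsimp)
  fix V' E' assume sub: "hsubgraph (V', E') (residue_tripartite m)" and "hisomorphic H_graph (V', E')"
  then obtain \<phi> :: "nat \<Rightarrow> nat" where "E' = (\<lambda>e. \<phi> ` e) ` hedges H_graph"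
    unfolding hisomorphic_def by auto
  then have "{\<phi> 1, \<phi> 2, \<phi> 3} \<in> E'" "{\<phi> 1, \<phi> 2, \<phi> 4} \<in> E'" "{\<phi> 3, \<phi> 4, \<phi> 5} \<in> E'"
    by (auto simp: H_graph_def)
  then have edges: "{\<phi> 1, \<phi> 2, \<phi> 3} \<in> hedges (residue_tripartite m)"
    "{\<phi> 1, \<phi> 2, \<phi> 4} \<in> hedges (residue_tripartite m)"
    "{\<phi> 3, \<phi> 4, \<phi> 5} \<in> hedges (residue_tripartite m)"
    using sub unfolding hsubgraph_def by auto
  note rainbow = edges[THEN residue_tripartite_rainbow(1)] edges[THEN residue_tripartite_rainbow(2)]
    edges[THEN residue_tripartite_rainbow(3)]
  have third: "p + q + r = 3" if "p < 3" "q < 3" "r < 3" "p \<noteq> q" "p \<noteq> r" "q \<noteq> r" for p q r :: nat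
    using that by linarith
  have "\<phi> 1 mod 3 + \<phi> 2 mod 3 + \<phi> 3 mod 3 = 3" "\<phi> 1 mod 3 + \<phi> 2 mod 3 + \<phi> 4 mod 3 = 3"
    by (rule third; (rule rainbow | simp; fail))+
  then have "\<phi> 3 mod 3 = \<phi> 4 mod 3" by linarith
  with residue_tripartite_rainbow(1)[OF edges(3)] show False by (rule notE)
qed

text \<open>
  Since the limit exists, it may be computed along the multiples of $3$, where the three parts have
  equal size.
\<close>

lemma turan_density_H_graph_ge: "2 / 9 \<le> turan_density {H_graph}"
proof -
  have ex: "m ^ 3 \<le> ex_number (3 * m) {H_graph}" for m
  proof -
    have "three_graph (residue_tripartite m)"
      unfolding three_graph_def
    proof (intro conjI ballI)
      fix e assume "e \<in> hedges (residue_tripartite m)"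
      then obtain x y z where e: "e = {3 * x, 3 * y + 1, 3 * z + 2}" and lt: "x < m" "y < m" "z < m"
        by (auto simp: residue_tripartite_def)
      have "3 * x \<noteq> 3 * y + 1" "3 * x \<noteq> 3 * z + 2" "3 * y + 1 \<noteq> 3 * z + 2" by presburger+
      then show "card e = 3" unfolding e by (simp only: card_3_iff) blast
      show "e \<subseteq> hverts (residue_tripartite m)" using lt by (simp add: e residue_tripartite_def)
    qed (simp add: residue_tripartite_def)
    moreover have "card (hverts (residue_tripartite m)) = 3 * m"
      by (simp add: residue_tripartite_def)
    ultimately have "m ^ 3 \<in> ex_candidates (3 * m) {H_graph}"
      using card_residue_tripartite[of m] family_free_residue_tripartite[of m]
      unfolding ex_candidates_def mem_Collect_eq by metis
    then show ?thesis unfolding ex_number_def by (rule Max_ge[OF ex_candidates_finite])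
  qed
  have sub: "filterlim (\<lambda>m. 3 * m) sequentially sequentially"
    by (rule filterlim_subseq) (simp add: strict_mono_def)
  have lim: "(\<lambda>m. real (3 * m) ^ 3 / real (3 * m choose 3) / 27) \<longlonglongrightarrow> 6 / 27"
    by (intro tendsto_divide filterlim_compose[OF cube_over_choose_3_tendsto sub] tendsto_const) simp
  have "6 / 27 \<le> turan_density {H_graph}"
  proof (rule LIMSEQ_le[OF lim filterlim_compose[OF turan_density_H_graph_LIMSEQ sub]])
    have "real (3 * m) ^ 3 / real (3 * m choose 3) / 27
        \<le> real (ex_number (3 * m) {H_graph}) / real (3 * m choose 3)" for m
    proof -
      have "real (3 * m) ^ 3 / real (3 * m choose 3) / 27 = real (m ^ 3) / real (3 * m choose 3)"
        by (simp add: power_mult_distrib)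
      also have "\<dots> \<le> real (ex_number (3 * m) {H_graph}) / real (3 * m choose 3)"
        using ex[of m] by (intro divide_right_mono) (simp_all only: of_nat_le_iff of_nat_0_le_iff)
      finally show ?thesis .
    qed
    then show "\<exists>N. \<forall>m\<ge>N. real (3 * m) ^ 3 / real (3 * m choose 3) / 27
        \<le> real (ex_number (3 * m) {H_graph}) / real (3 * m choose 3)" by blast
  qed
  then show ?thesis by simp
qed

theorem theorem12: "turan_density {H_graph} = 2 / 9"
  by (rule antisym[OF turan_density_H_graph_le turan_density_H_graph_ge])

end
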